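(* Let $m\ge 1$ be an integer. In the following, $i,j$ range over integers $\ge 1$ with $i+j=m+1$, and "solution for $2n$" means a pair $(x,y)$ of primes $x,y>3$ with $x+y=2n$. (First quadrant) Let $2n=14+6(m-1)\equiv 2 \pmod 6$. All pairs $(6i+1,6j+1)$ have coordinate sum $2n$, and every solution for $2n$ is one of these pairs. (Second quadrant) Let $2n=12+6(m-1)\equiv 0\pmod 6$. All pairs $(6i-1,6j+1)$ have coordinate sum $2n$, and every solution for $2n$ is, up to interchanging the two coordinates, one of these pairs. (Third quadrant) Let $2n=10+6(m-1)\equiv -2\pmod 6$. All pairs $(6i-1,6j-1)$ have coordinate sum $2n$, and every solution for $2n$ is one of these pairs. (Fourth quadrant) As in the second quadrant with interchanged coordinates: for $2n=12+6(m-1)$, all pairs $(6i+1,6j-1)$ have coordinate sum $2n$, and every solution for $2n$ is one of the pairs of the second or of the fourth quadrant. Thus the solution set of the binary Goldbach problem with primes greater than $3$ is a subset of the system of these sides, $m=1,2,3,\dots$, the four sides with common $m$ forming one Goldbach rhombus.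
   Context: Let $H=\{6k+1:k\in\mathbb Z\}$, $H_+=\{6k+1 : k\ge 0\}$ and $H_-=\{6k-1: k\ge 0\}$ (the negative branch of $H$ reflected to the positive side). The coordinates of the points are elements of $H_+$ and $H_-$ with index ("carrier") at least $1$. The four quadrants are those of the lattice $H\times H$ with origin $(1,1)$, with negative coordinates replaced by their absolute values; for fixed $m$ the four sets of pairs are the four sides of a rhombus. *)

theory Defs
  imports Main "HOL-Number_Theory.Cong" "HOL-Computational_Algebra.Primes"
begin

definition goldbach_solutions :: "int \<Rightarrow> (int \<times> int) set" where
  "goldbach_solutions n =
     {(x, y). prime x \<and> prime y \<and> 3 < x \<and> 3 < y \<and> x + y = 2 * n}"

definition side1 :: "int \<Rightarrow> (int \<times> int) set" where
  "side1 m = {(6 * i + 1, 6 * j + 1) | i j. 1 \<le> i \<and> 1 \<le> j \<and> i + j = m + 1}"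

definition side2 :: "int \<Rightarrow> (int \<times> int) set" where
  "side2 m = {(6 * i - 1, 6 * j + 1) | i j. 1 \<le> i \<and> 1 \<le> j \<and> i + j = m + 1}"

definition side3 :: "int \<Rightarrow> (int \<times> int) set" where
  "side3 m = {(6 * i - 1, 6 * j - 1) | i j. 1 \<le> i \<and> 1 \<le> j \<and> i + j = m + 1}"

definition side4 :: "int \<Rightarrow> (int \<times> int) set" where
  "side4 m = {(6 * i + 1, 6 * j - 1) | i j. 1 \<le> i \<and> 1 \<le> j \<and> i + j = m + 1}"

definition H :: "int set" where
  "H = {6 * k + 1 | k. True}"

text \<open>The quadrants of the lattice \<open>H \<times> H\<close> with origin \<open>(1, 1)\<close>. The axes, i.e. the
  points having a coordinate with index \<open>0\<close>, belong to no quadrant.\<close>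

definition quadrant1 :: "(int \<times> int) set" where
  "quadrant1 = {(x, y) \<in> H \<times> H. 1 < x \<and> 1 < y}"

definition quadrant2 :: "(int \<times> int) set" where
  "quadrant2 = {(x, y) \<in> H \<times> H. x < 1 \<and> 1 < y}"

definition quadrant3 :: "(int \<times> int) set" where
  "quadrant3 = {(x, y) \<in> H \<times> H. x < 1 \<and> y < 1}"

definition quadrant4 :: "(int \<times> int) set" where
  "quadrant4 = {(x, y) \<in> H \<times> H. 1 < x \<and> y < 1}"

text \<open>The rhombus with centre \<open>(1, 1)\<close> and vertices \<open>(1 \<plusminus> 6 (m + 1), 1)\<close> and
  \<open>(1, 1 \<plusminus> 6 (m + 1))\<close>, as the set of those lattice points on its four sides that are
  not vertices; the coordinates still carry their signs.\<close>

definition goldbach_rhombus :: "int \<Rightarrow> (int \<times> int) set" where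
  "goldbach_rhombus m =
     {(x, y) \<in> H \<times> H. x \<noteq> 1 \<and> y \<noteq> 1 \<and> \<bar>x - 1\<bar> + \<bar>y - 1\<bar> = 6 * (m + 1)}"

definition abs_coords :: "int \<times> int \<Rightarrow> int \<times> int" where
  "abs_coords = (\<lambda>(x, y). (\<bar>x\<bar>, \<bar>y\<bar>))"

end

theory Submission
  imports Defs
begin

text \<open>A prime above 3 is divisible by neither 2 nor 3, so it is 1 or -1 mod 6, that is
  \<open>6 * i + 1\<close> or \<open>6 * i - 1\<close> with \<open>i\<close> at least 1
  (\<open>prime_gt_3_cases\<close>). A pair of such primes thus has one of four sign patterns, and
  with \<open>m = i + j - 1\<close> its sum is \<open>6 * m + 8\<close>, \<open>6 * m + 6\<close>
  (both mixed patterns) or \<open>6 * m + 4\<close>. The residue of \<open>n\<close> mod 3 therefore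
  determines the pattern up to swapping coordinates, and then \<open>n\<close> determines
  \<open>m\<close>; this is \<open>goldbach_solutions_subset_sides\<close>.

  For the geometry, the element of \<open>H\<close> with index \<open>-i\<close> is
  \<open>-(6 * i - 1)\<close>, so elements with indices \<open>i\<close> and \<open>-i\<close> both
  lie at distance \<open>6 * i\<close> from 1. On the rhombus, the l1-sphere of radius
  \<open>6 * (m + 1)\<close> about \<open>(1, 1)\<close>, the distance equation hence reads
  \<open>i + j = m + 1\<close> in every quadrant, and taking absolute values gives the four
  sides.\<close>

lemma prime_gt_3_cases:
  fixes p :: int
  assumes "prime p" and "3 < p"
  obtains i where "1 \<le> i" and "p = 6 * i + 1" | i where "1 \<le> i" and "p = 6 * i - 1"
proof -
  \<comment> \<open>A prime divisible by the prime 2 or 3 would equal it, but \<open>p\<close>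
    exceeds 3.\<close>
  have ndvd: "\<not> 2 dvd p" "\<not> 3 dvd p"
    using assms primes_dvd_imp_eq[of 2 p] primes_dvd_imp_eq[of 3 p] by auto
  then have "p mod 6 = 1 \<or> p mod 6 = 5"
    by presburger
  then show thesis
  proof
    assume "p mod 6 = 1"
    then have "1 \<le> p div 6" "p = 6 * (p div 6) + 1"
      using assms(2) by presburger+
    then show thesis by (rule that(1))
  next
    assume "p mod 6 = 5"
    \<comment> \<open>Residue 5 is -1 counted from the next multiple of 6, so the index is one more
      than the quotient.\<close>
    then have "1 \<le> p div 6 + 1" "p = 6 * (p div 6 + 1) - 1"
      using assms(2) by presburger+
    then show thesis by (rule that(2))
  qed
qed

text \<open>The two primes choose their signs independently, giving four cases. The witness
  \<open>i + j - 1\<close> is at least 1 because both indices are, and \<open>n\<close> is half of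
  \<open>6 * (i + j)\<close> plus 2, 0 or -2.\<close>

lemma goldbach_solutions_cases:
  assumes "(x, y) \<in> goldbach_solutions n"
  obtains m where "1 \<le> m" and "n = 3 * m + 4" and "(x, y) \<in> side1 m"
  | m where "1 \<le> m" and "n = 3 * m + 3" and "(x, y) \<in> side2 m"
  | m where "1 \<le> m" and "n = 3 * m + 2" and "(x, y) \<in> side3 m"
  | m where "1 \<le> m" and "n = 3 * m + 3" and "(x, y) \<in> side4 m"
proof -
  have xy: "prime x" "3 < x" "prime y" "3 < y" and sum: "x + y = 2 * n"
    using assms by (auto simp: goldbach_solutions_def)
  show thesis
  proof (cases rule: prime_gt_3_cases[OF xy(1,2)];
      cases rule: prime_gt_3_cases[OF xy(3,4)])
    fix i j :: int
    assume "1 \<le> i" "x = 6 * i + 1" "1 \<le> j" "y = 6 * j + 1"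
    then show thesis using sum by (intro that(1)[of "i + j - 1"]) (auto simp: side1_def)
  next
    fix i j :: int
    assume "1 \<le> i" "x = 6 * i + 1" "1 \<le> j" "y = 6 * j - 1"
    then show thesis using sum by (intro that(4)[of "i + j - 1"]) (auto simp: side4_def)
  next
    fix i j :: int
    assume "1 \<le> i" "x = 6 * i - 1" "1 \<le> j" "y = 6 * j + 1"
    then show thesis using sum by (intro that(2)[of "i + j - 1"]) (auto simp: side2_def)
  next
    fix i j :: int
    assume "1 \<le> i" "x = 6 * i - 1" "1 \<le> j" "y = 6 * j - 1"
    then show thesis using sum by (intro that(3)[of "i + j - 1"]) (auto simp: side3_def)
  qed
qed

lemma side_sums:
  "(x, y) \<in> side1 m \<Longrightarrow> x + y = 6 * m + 8"
  "(x, y) \<in> side2 m \<Longrightarrow> x + y = 6 * m + 6"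
  "(x, y) \<in> side3 m \<Longrightarrow> x + y = 6 * m + 4"
  "(x, y) \<in> side4 m \<Longrightarrow> x + y = 6 * m + 6"
  by (auto simp: side1_def side2_def side3_def side4_def)

lemma swap_side4_iff_side2: "(y, x) \<in> side2 m \<longleftrightarrow> (x, y) \<in> side4 m"
  by (auto simp: side2_def side4_def add.commute)

lemma goldbach_solutions_subset_sides:
  "goldbach_solutions (3 * m + 4) \<subseteq> side1 m"
  "goldbach_solutions (3 * m + 3) \<subseteq> side2 m \<union> side4 m"
  "goldbach_solutions (3 * m + 2) \<subseteq> side3 m"
proof -
  \<comment> \<open>The three forms of \<open>n\<close> lie in different classes mod 3, which
    excludes the wrong sign patterns; within the right one, equal \<open>n\<close> forces equal
    \<open>m\<close>.\<close>
  have *: "3 * m + 4 \<noteq> 3 * k + 3" "3 * m + 4 \<noteq> 3 * k + 2" "3 * m + 3 \<noteq> 3 * k + 4"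
    "3 * m + 3 \<noteq> 3 * k + 2" "3 * m + 2 \<noteq> 3 * k + 4" "3 * m + 2 \<noteq> 3 * k + 3" for k
    by presburger+
  show "goldbach_solutions (3 * m + 4) \<subseteq> side1 m"
    by (auto elim!: goldbach_solutions_cases simp: *)
  show "goldbach_solutions (3 * m + 3) \<subseteq> side2 m \<union> side4 m"
    by (auto elim!: goldbach_solutions_cases simp: *)
  show "goldbach_solutions (3 * m + 2) \<subseteq> side3 m"
    by (auto elim!: goldbach_solutions_cases simp: *)
qed

lemma in_H_gt_1_iff: "x \<in> H \<and> 1 < x \<longleftrightarrow> (\<exists>i\<ge>1. x = 6 * i + 1)"
  unfolding H_def mem_Collect_eq by presburger

text \<open>Since \<open>6 * (-i) + 1 = -(6 * i - 1)\<close>, reflecting the negative branch of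
  \<open>H\<close> produces the numbers \<open>6 * i - 1\<close>.\<close>

lemma in_H_lt_1_iff: "x \<in> H \<and> x < 1 \<longleftrightarrow> (\<exists>i\<ge>1. x = - (6 * i - 1))"
  unfolding H_def mem_Collect_eq by presburger

lemma goldbach_rhombus_Int_quadrants:
  "goldbach_rhombus m \<inter> quadrant1 =
    {(6 * i + 1, 6 * j + 1) | i j. 1 \<le> i \<and> 1 \<le> j \<and> i + j = m + 1}" (is ?q1)
  "goldbach_rhombus m \<inter> quadrant2 =
    {(- (6 * i - 1), 6 * j + 1) | i j. 1 \<le> i \<and> 1 \<le> j \<and> i + j = m + 1}" (is ?q2)
  "goldbach_rhombus m \<inter> quadrant3 =
    {(- (6 * i - 1), - (6 * j - 1)) | i j. 1 \<le> i \<and> 1 \<le> j \<and> i + j = m + 1}" (is ?q3)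
  "goldbach_rhombus m \<inter> quadrant4 =
    {(6 * i + 1, - (6 * j - 1)) | i j. 1 \<le> i \<and> 1 \<le> j \<and> i + j = m + 1}" (is ?q4)
proof -
  \<comment> \<open>The conditions are regrouped by coordinate so that the parametrisations of the
    branches of \<open>H\<close> apply; after substitution each absolute value is 6 times an
    index.\<close>
  have "goldbach_rhombus m \<inter> quadrant1 =
      {(x, y). (x \<in> H \<and> 1 < x) \<and> (y \<in> H \<and> 1 < y) \<and> \<bar>x - 1\<bar> + \<bar>y - 1\<bar> = 6 * (m + 1)}"
    by (auto simp: goldbach_rhombus_def quadrant1_def)
  then show ?q1
    unfolding in_H_gt_1_iff by auto
  have "goldbach_rhombus m \<inter> quadrant2 =
      {(x, y). (x \<in> H \<and> x < 1) \<and> (y \<in> H \<and> 1 < y) \<and> \<bar>x - 1\<bar> + \<bar>y - 1\<bar> = 6 * (m + 1)}"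
    by (auto simp: goldbach_rhombus_def quadrant2_def)
  then show ?q2
    unfolding in_H_gt_1_iff in_H_lt_1_iff by auto
  have "goldbach_rhombus m \<inter> quadrant3 =
      {(x, y). (x \<in> H \<and> x < 1) \<and> (y \<in> H \<and> y < 1) \<and> \<bar>x - 1\<bar> + \<bar>y - 1\<bar> = 6 * (m + 1)}"
    by (auto simp: goldbach_rhombus_def quadrant3_def)
  then show ?q3
    unfolding in_H_lt_1_iff by auto
  have "goldbach_rhombus m \<inter> quadrant4 =
      {(x, y). (x \<in> H \<and> 1 < x) \<and> (y \<in> H \<and> y < 1) \<and> \<bar>x - 1\<bar> + \<bar>y - 1\<bar> = 6 * (m + 1)}"
    by (auto simp: goldbach_rhombus_def quadrant4_def)
  then show ?q4
    unfolding in_H_gt_1_iff in_H_lt_1_iff by auto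
qed

text \<open>The constraint concerns the indices only, so absolute values can be taken in each
  coordinate separately.\<close>

lemma abs_coords_image_pairs:
  fixes f g :: "int \<Rightarrow> int"
  assumes "\<And>i. 1 \<le> i \<Longrightarrow> \<bar>f i\<bar> = f' i" and "\<And>j. 1 \<le> j \<Longrightarrow> \<bar>g j\<bar> = g' j"
  shows "abs_coords ` {(f i, g j) | i j. 1 \<le> i \<and> 1 \<le> j \<and> i + j = s} =
    {(f' i, g' j) | i j. 1 \<le> i \<and> 1 \<le> j \<and> i + j = s}"
  (is "_ ` ?A = ?B")
proof
  show "abs_coords ` ?A \<subseteq> ?B"
    using assms by (fastforce simp: abs_coords_def)
  show "?B \<subseteq> abs_coords ` ?A"
  proof
    fix p assume "p \<in> ?B"
    then obtain i j where ij: "p = (f' i, g' j)" "1 \<le> i" "1 \<le> j" "i + j = s" by blast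
    then have "p = abs_coords (f i, g j)" using assms by (simp add: abs_coords_def)
    then show "p \<in> abs_coords ` ?A" using ij by blast
  qed
qed

lemma sides_eq_abs_coords_image:
  "side1 m = abs_coords ` (goldbach_rhombus m \<inter> quadrant1)"
  "side2 m = abs_coords ` (goldbach_rhombus m \<inter> quadrant2)"
  "side3 m = abs_coords ` (goldbach_rhombus m \<inter> quadrant3)"
  "side4 m = abs_coords ` (goldbach_rhombus m \<inter> quadrant4)"
  unfolding goldbach_rhombus_Int_quadrants side1_def side2_def side3_def side4_def
  by (rule abs_coords_image_pairs[symmetric]; simp)+

lemma goldbach_rhombus_subset_quadrants:
  "goldbach_rhombus m \<subseteq> quadrant1 \<union> quadrant2 \<union> quadrant3 \<union> quadrant4"
  by (auto simp: goldbach_rhombus_def quadrant1_def quadrant2_def quadrant3_def quadrant4_def)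

lemma sides_Un_eq_abs_coords_image:
  "side1 m \<union> side2 m \<union> side3 m \<union> side4 m = abs_coords ` goldbach_rhombus m"
  \<comment> \<open>The four images merge into the image of the rhombus cut by all quadrants, which
    is the whole rhombus because its points avoid both axes.\<close>
  unfolding sides_eq_abs_coords_image image_Un[symmetric] Int_Un_distrib[symmetric]
  using goldbach_rhombus_subset_quadrants by (simp add: Int_absorb2)

theorem mainTheorem5:
  shows "(\<forall>m n :: int. 1 \<le> m \<and> 2 * n = 14 + 6 * (m - 1) \<longrightarrow>
            [2 * n = 2] (mod 6) \<and>
            (\<forall>(x, y) \<in> side1 m. x + y = 2 * n) \<and>
            (\<forall>(x, y) \<in> goldbach_solutions n. (x, y) \<in> side1 m))
       \<and> (\<forall>m n :: int. 1 \<le> m \<and> 2 * n = 12 + 6 * (m - 1) \<longrightarrow>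
            [2 * n = 0] (mod 6) \<and>
            (\<forall>(x, y) \<in> side2 m. x + y = 2 * n) \<and>
            (\<forall>(x, y) \<in> goldbach_solutions n. (x, y) \<in> side2 m \<or> (y, x) \<in> side2 m))
       \<and> (\<forall>m n :: int. 1 \<le> m \<and> 2 * n = 10 + 6 * (m - 1) \<longrightarrow>
            [2 * n = - 2] (mod 6) \<and>
            (\<forall>(x, y) \<in> side3 m. x + y = 2 * n) \<and>
            (\<forall>(x, y) \<in> goldbach_solutions n. (x, y) \<in> side3 m))
       \<and> (\<forall>m n :: int. 1 \<le> m \<and> 2 * n = 12 + 6 * (m - 1) \<longrightarrow>
            (\<forall>(x, y) \<in> side4 m. x + y = 2 * n) \<and>
            (\<forall>(x, y) \<in> goldbach_solutions n. (x, y) \<in> side2 m \<union> side4 m))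
       \<and> (\<Union>n. goldbach_solutions n)
            \<subseteq> (\<Union>m \<in> {1..}. side1 m \<union> side2 m \<union> side3 m \<union> side4 m)
       \<and> (\<forall>m :: int. 1 \<le> m \<longrightarrow>
            side1 m = abs_coords ` (goldbach_rhombus m \<inter> quadrant1) \<and>
            side2 m = abs_coords ` (goldbach_rhombus m \<inter> quadrant2) \<and>
            side3 m = abs_coords ` (goldbach_rhombus m \<inter> quadrant3) \<and>
            side4 m = abs_coords ` (goldbach_rhombus m \<inter> quadrant4) \<and>
            side1 m \<union> side2 m \<union> side3 m \<union> side4 m = abs_coords ` goldbach_rhombus m)"
proof (intro conjI allI impI; (elim conjE)?)
  fix m n :: int
  assume "2 * n = 14 + 6 * (m - 1)"
  then have n: "n = 3 * m + 4" by simp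
  show "[2 * n = 2] (mod 6)"
    using n unfolding cong_iff_dvd_diff by presburger
  show "\<forall>(x, y) \<in> side1 m. x + y = 2 * n"
    using side_sums(1) n by fastforce
  show "\<forall>(x, y) \<in> goldbach_solutions n. (x, y) \<in> side1 m"
    using goldbach_solutions_subset_sides(1) n by blast
next
  fix m n :: int
  assume "2 * n = 12 + 6 * (m - 1)"
  then have n: "n = 3 * m + 3" by simp
  show "[2 * n = 0] (mod 6)"
    using n unfolding cong_iff_dvd_diff by presburger
  show "\<forall>(x, y) \<in> side2 m. x + y = 2 * n"
    using side_sums(2) n by fastforce
  \<comment> \<open>A solution on the fourth side becomes one on the second after interchanging
    coordinates.\<close>
  show "\<forall>(x, y) \<in> goldbach_solutions n. (x, y) \<in> side2 m \<or> (y, x) \<in> side2 m"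
    using goldbach_solutions_subset_sides(2) n swap_side4_iff_side2 by blast
  show "\<forall>(x, y) \<in> side4 m. x + y = 2 * n"
    using side_sums(4) n by fastforce
  show "\<forall>(x, y) \<in> goldbach_solutions n. (x, y) \<in> side2 m \<union> side4 m"
    using goldbach_solutions_subset_sides(2) n by blast
next
  fix m n :: int
  assume "2 * n = 10 + 6 * (m - 1)"
  then have n: "n = 3 * m + 2" by simp
  show "[2 * n = - 2] (mod 6)"
    using n unfolding cong_iff_dvd_diff by presburger
  show "\<forall>(x, y) \<in> side3 m. x + y = 2 * n"
    using side_sums(3) n by fastforce
  show "\<forall>(x, y) \<in> goldbach_solutions n. (x, y) \<in> side3 m"
    using goldbach_solutions_subset_sides(3) n by blast
next
  show "(\<Union>n. goldbach_solutions n)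
      \<subseteq> (\<Union>m \<in> {1..}. side1 m \<union> side2 m \<union> side3 m \<union> side4 m)"
    by (fastforce elim: goldbach_solutions_cases)
qed (rule sides_eq_abs_coords_image sides_Un_eq_abs_coords_image)+

end
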